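(* Let $G$ be a digraph consisting of two cycles, each of length at least $3$, that have exactly $m\ge 1$ common edges. If the shorter cycle is of length at most $m+2$, then there is a complete realisation of $G\subset G'$ (for a suitable $G'$ obtained from $G$ by adding edges between existing vertices) such that the only positive transverse eigenvalue of the shorter cycle is at the distribution node, i.e. at the equilibrium corresponding to the distribution vertex of $G$.
   Context: Digraphs. All digraphs $G=(V,A)$ are finite, with at most one edge $[v_j\to v_i]$ for each ordered pair of vertices. A digraph consists of two cycles if it is the connected union of two different directed cycles and contains no other cycles. Then the common edges form a single uninterrupted directed path. Such a digraph has exactly one vertex of out-degree greater than $1$, called the distribution vertex. If the cycle lengths (numbers of vertices) $k,\ell$ satisfy $k\le\ell$, the $k$-cycle is called the shorter and the $\ell$-cycle the longer cycle. Simplex method. Let $G'=(V,A')$ be a strongly connected digraph on $V=\{v_1,\dots,v_n\}$ without 1-cycles and 2-cycles. The simplex method associates with $G'$ the system on $\mathbb{R}^n$ $$\dot x_i = x_i\Big(1-|x|^2+\sum_{j=1}^n a_{ji}x_j^2\Big),\quad i=1,\dots,n,$$ with $a_{ii}=0$, and for $i\ne j$: $a_{ji}>0$ if $[v_j\to v_i]\in A'$ and $a_{ji}<0$ otherwise. The vertex $v_j$ corresponds to the equilibrium $\xi_j$, the unit vector on the positive $x_j$-axis; the eigenvalue of the linearisation at $\xi_j$ in the direction of $x_i$ ($i\neq j$) is $a_{ji}$ and the radial eigenvalue is $-2$. For each edge $[v_j\to v_i]\in A'$ there is a heteroclinic connection $[\xi_j\to\xi_i]$ (a non-empty intersection $W^u(\xi_j)\cap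 W^s(\xi_i)$) containing a trajectory in the $(x_j,x_i)$-coordinate plane. The system is equivariant under $\mathbb{Z}_2^n$ acting by reflections in the coordinate hyperplanes, and equilibria and connections are understood up to this symmetry (equivalently, one works in the closed orthant $x_i\ge 0$). The heteroclinic network $X$ realising $G'$ consists of the equilibria $\xi_j$ and the full sets of connections $W^u(\xi_j)\cap W^s(\xi_i)$. Completeness. A heteroclinic network is complete if it contains the unstable manifolds of all its equilibria, i.e. every trajectory in every $W^u(\xi_j)$ converges in forward time to one of the equilibria of the network. Complete realisation. For a strongly connected digraph $G=(V,A)$ without 1- and 2-cycles and a digraph $G'=(V,A')$ with the same vertex set, $A\subset A'$ (possibly $A'=A$), and without 1- and 2-cycles, $G\subset G'$ has a complete realisation if the simplex method applied to $G'$ (with suitable coefficients of the prescribed signs) produces a complete heteroclinic network $X$; then $X$ is called a complete realisation of $G\subset G'$. Transverse eigenvalues. Let $C$ be a cycle of $G$, viewed as a heteroclinic cycle in $X$ using the connecting trajectories in coordinate planes. At an equilibrium $\xi_j$ of $C$, with predecessor $\xi_p$ and successor $\xi_s$ in $C$, the eigenvalue in direction $x_j$ is radial, in direction $x_p$ contracting, in direction $x_s$ expanding, and the eigenvalues $a_{ji}$ in all remaining directions $x_i$, $i\notin\{j,p,s\}$, are the transverse eigenvalues of $C$ at $\xi_j$. *)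

theory Defs
  imports "HOL-Analysis.Analysis" "Graph_Theory.Graph_Theory"
begin

text \<open>
  Digraphs are values of type \<open>'v pair_pre_digraph\<close>, i.e. a vertex set and a set of
  ordered pairs, with \<^term>\<open>(u, v)\<close> standing for the edge from \<open>u\<close> to \<open>v\<close>. Since the vertices index
  the coordinates of the phase space \<open>real ^ 'v\<close>, the vertex set is always
  the whole finite type \<open>'v\<close>. A cycle is a list of edges; rotations of the list represent the same
  cycle, so cycles are compared through their edge sets.
\<close>

definition no_12_cycles :: "'v pair_pre_digraph \<Rightarrow> bool" where
  "no_12_cycles G \<longleftrightarrow> (\<forall>r. pre_digraph.cycle (with_proj G) r \<longrightarrow> length r \<noteq> 1 \<and> length r \<noteq> 2)"

definition consists_of_two_cycles ::
    "'v pair_pre_digraph \<Rightarrow> ('v \<times> 'v) list \<Rightarrow> ('v \<times> 'v) list \<Rightarrow> bool" where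
  "consists_of_two_cycles G p q \<longleftrightarrow>
     pre_digraph.cycle (with_proj G) p \<and> pre_digraph.cycle (with_proj G) q \<and> set p \<noteq> set q \<and>
     parcs G = set p \<union> set q \<and> pverts G = fst ` set p \<union> fst ` set q \<and>
     Digraph_Component.connected (with_proj G) \<and>
     (\<forall>r. pre_digraph.cycle (with_proj G) r \<longrightarrow> set r = set p \<or> set r = set q)"

definition distribution_vertex :: "'v pair_pre_digraph \<Rightarrow> 'v" where
  "distribution_vertex G = (THE v. out_degree (with_proj G) v > 1)"


text \<open>The coefficient written with subscripts \<open>ji\<close> in the mathematics is \<open>a j i\<close>.\<close>

definition simplex_field :: "('v::finite \<Rightarrow> 'v \<Rightarrow> real) \<Rightarrow> real ^ 'v \<Rightarrow> real ^ 'v" where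
  "simplex_field a x = (\<chi> i. x $ i * (1 - (norm x)\<^sup>2 + (\<Sum>j\<in>UNIV. a j i * (x $ j)\<^sup>2)))"

definition simplex_coeffs :: "'v pair_pre_digraph \<Rightarrow> ('v \<Rightarrow> 'v \<Rightarrow> real) \<Rightarrow> bool" where
  "simplex_coeffs G a \<longleftrightarrow>
     (\<forall>i. a i i = 0) \<and>
     (\<forall>i j. i \<noteq> j \<longrightarrow> (if (j, i) \<in> parcs G then a j i > 0 else a j i < 0))"

definition xi :: "'v::finite \<Rightarrow> real ^ 'v" where
  "xi j = axis j 1"

definition orthant :: "(real ^ 'v::finite) set" where
  "orthant = {x. \<forall>i. 0 \<le> x $ i}"

text \<open>
  Invariant manifolds are formed inside the closed nonnegative orthant, which is a fundamental
  domain for the reflections. Membership of \<open>x0\<close> in the unstable manifold only requires a solution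
  on the half-line of nonpositive times, and in the stable manifold only one on the half-line of
  nonnegative times. Hence a trajectory of an unstable manifold that blows up in finite forward time
  counts against completeness.
\<close>

definition unstable_manifold :: "('v::finite \<Rightarrow> 'v \<Rightarrow> real) \<Rightarrow> 'v \<Rightarrow> (real ^ 'v) set" where
  "unstable_manifold a j = {x0 \<in> orthant. \<exists>x.
     x 0 = x0 \<and>
     (\<forall>t\<in>{..0}. (x has_vector_derivative simplex_field a (x t)) (at t within {..0})) \<and>
     (x \<longlongrightarrow> xi j) at_bot}"

definition stable_manifold :: "('v::finite \<Rightarrow> 'v \<Rightarrow> real) \<Rightarrow> 'v \<Rightarrow> (real ^ 'v) set" where
  "stable_manifold a i = {x0 \<in> orthant. \<exists>x.
     x 0 = x0 \<and>
     (\<forall>t\<in>{0..}. (x has_vector_derivative simplex_field a (x t)) (at t within {0..})) \<and>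
     (x \<longlongrightarrow> xi i) at_top}"

definition connections :: "('v::finite \<Rightarrow> 'v \<Rightarrow> real) \<Rightarrow> 'v \<Rightarrow> 'v \<Rightarrow> (real ^ 'v) set" where
  "connections a j i = unstable_manifold a j \<inter> stable_manifold a i"

definition coordinate_plane :: "'v::finite \<Rightarrow> 'v \<Rightarrow> (real ^ 'v) set" where
  "coordinate_plane j i = {x. \<forall>l. l \<noteq> j \<and> l \<noteq> i \<longrightarrow> x $ l = 0}"

definition network :: "('v::finite \<Rightarrow> 'v \<Rightarrow> real) \<Rightarrow> (real ^ 'v) set" where
  "network a = range xi \<union> (\<Union>j. \<Union>i. connections a j i)"

definition network_realises :: "('v::finite \<Rightarrow> 'v \<Rightarrow> real) \<Rightarrow> 'v pair_pre_digraph \<Rightarrow> bool" where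
  "network_realises a G \<longleftrightarrow>
     (\<forall>j i. (j, i) \<in> parcs G \<longrightarrow> connections a j i \<inter> coordinate_plane j i \<noteq> {})"

definition complete_network :: "('v::finite \<Rightarrow> 'v \<Rightarrow> real) \<Rightarrow> bool" where
  "complete_network a \<longleftrightarrow> (\<forall>j. unstable_manifold a j \<subseteq> network a)"

text \<open>
  The network produced by the simplex method is determined by the coefficients, so a complete
  realisation of \<open>G \<subset> G'\<close> is given by \<open>G'\<close> and \<open>a\<close>.
\<close>

definition complete_realisation ::
    "'v::finite pair_pre_digraph \<Rightarrow> 'v pair_pre_digraph \<Rightarrow> ('v \<Rightarrow> 'v \<Rightarrow> real) \<Rightarrow> bool" where
  "complete_realisation G G' a \<longleftrightarrow>
     pverts G = UNIV \<and> strongly_connected (with_proj G) \<and> no_12_cycles G \<and>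
     pverts G' = UNIV \<and> strongly_connected (with_proj G') \<and> no_12_cycles G' \<and>
     parcs G \<subseteq> parcs G' \<and>
     simplex_coeffs G' a \<and> network_realises a G' \<and> complete_network a"

definition linearisation :: "('v::finite \<Rightarrow> 'v \<Rightarrow> real) \<Rightarrow> 'v \<Rightarrow> real ^ 'v \<Rightarrow> real ^ 'v" where
  "linearisation a j = frechet_derivative (simplex_field a) (at (xi j))"

lemma linearisation_axis:
  fixes a :: "'v::finite \<Rightarrow> 'v \<Rightarrow> real"
  assumes "a j j = 0"
  shows "linearisation a j (axis i 1) = (if i = j then - 2 else a j i) *\<^sub>R axis i 1"
proof -
  let ?D = "\<lambda>h. (\<chi> i. if i = j then - 2 * h $ j else a j i * h $ i) :: real ^ 'v"
  have "(simplex_field a has_derivative ?D) (at (xi j))"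
  proof (rule iffD2[OF has_derivative_componentwise_within], rule ballI)
    fix b :: "real ^ 'v" assume "b \<in> Basis"
    then obtain k where b: "b = axis k 1" by (auto simp: Basis_vec_def)
    have nth: "((\<lambda>x :: real ^ 'v. x $ l) has_derivative (\<lambda>h. h $ l)) (at (xi j))" for l
      by (rule bounded_linear.has_derivative[OF bounded_linear_vec_nth has_derivative_ident])
    have sq: "((\<lambda>x :: real ^ 'v. (x $ l)\<^sup>2) has_derivative (\<lambda>h. 2 * xi j $ l * h $ l)) (at (xi j))" for l
      using has_derivative_mult[OF nth[of l] nth[of l]] by (simp add: power2_eq_square algebra_simps)
    have "((\<lambda>x. x $ k * (1 - (\<Sum>l\<in>UNIV. (x $ l)\<^sup>2) + (\<Sum>l\<in>UNIV. a l k * (x $ l)\<^sup>2)))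
        has_derivative (\<lambda>h. xi j $ k * (0 - (\<Sum>l\<in>UNIV. 2 * xi j $ l * h $ l)
           + (\<Sum>l\<in>UNIV. a l k * (2 * xi j $ l * h $ l)))
         + h $ k * (1 - (\<Sum>l\<in>UNIV. (xi j $ l)\<^sup>2) + (\<Sum>l\<in>UNIV. a l k * (xi j $ l)\<^sup>2)))) (at (xi j))"
      by (intro has_derivative_mult nth has_derivative_add has_derivative_diff has_derivative_const
          has_derivative_sum has_derivative_mult_right sq)
    moreover have "(\<lambda>h. xi j $ k * (0 - (\<Sum>l\<in>UNIV. 2 * xi j $ l * h $ l)
           + (\<Sum>l\<in>UNIV. a l k * (2 * xi j $ l * h $ l)))
         + h $ k * (1 - (\<Sum>l\<in>UNIV. (xi j $ l)\<^sup>2) + (\<Sum>l\<in>UNIV. a l k * (xi j $ l)\<^sup>2)))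
       = (\<lambda>h. ?D h $ k)"
    proof
      fix h :: "real ^ 'v"
      have x: "xi j $ l = (if l = j then 1 else 0)" for l by (simp add: xi_def axis_def)
      have s: "(\<Sum>l\<in>UNIV. f l * (xi j $ l)) = f j" for f by (simp add: x if_distrib cong: if_cong)
      have "(\<Sum>l\<in>UNIV. 2 * xi j $ l * h $ l) = 2 * h $ j"
        using s[of "\<lambda>l. 2 * h $ l"] by (simp add: ac_simps)
      moreover have "(\<Sum>l\<in>UNIV. a l k * (2 * xi j $ l * h $ l)) = 2 * a j k * h $ j"
        using s[of "\<lambda>l. 2 * a l k * h $ l"] by (simp add: ac_simps)
      moreover have "(xi j $ l)\<^sup>2 = xi j $ l" for l by (simp add: x)
      moreover have "(\<Sum>l\<in>UNIV. xi j $ l) = 1" using s[of "\<lambda>l. 1"] by simp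
      ultimately show "xi j $ k * (0 - (\<Sum>l\<in>UNIV. 2 * xi j $ l * h $ l)
           + (\<Sum>l\<in>UNIV. a l k * (2 * xi j $ l * h $ l)))
         + h $ k * (1 - (\<Sum>l\<in>UNIV. (xi j $ l)\<^sup>2) + (\<Sum>l\<in>UNIV. a l k * (xi j $ l)\<^sup>2)) = ?D h $ k"
        using assms x[of k] s[of "\<lambda>l. a l k"] by simp
    qed
    ultimately show "((\<lambda>x. simplex_field a x \<bullet> b) has_derivative (\<lambda>x. ?D x \<bullet> b)) (at (xi j))"
      unfolding b simplex_field_def
      by (simp add: inner_commute[of _ "axis k 1"] inner_axis' norm_vec_def L2_set_def sum_nonneg)
  qed
  then have "linearisation a j = ?D"
    unfolding linearisation_def using frechet_derivative_at[symmetric] by blast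
  then show ?thesis by (auto simp: vec_eq_iff axis_def)
qed

text \<open>
  Pairs \<open>(j, i)\<close> such that the linearisation at \<open>xi j\<close> has a positive eigenvalue in the direction
  of the \<open>i\<close>-th coordinate, transverse to the cycle \<open>p\<close> (\<open>u\<close> and \<open>s\<close> are the predecessor and the
  successor of \<open>j\<close> in \<open>p\<close>).
\<close>

definition positive_transverse ::
    "('v::finite \<Rightarrow> 'v \<Rightarrow> real) \<Rightarrow> ('v \<times> 'v) list \<Rightarrow> ('v \<times> 'v) set" where
  "positive_transverse a p = {(j, i). \<exists>u s. (u, j) \<in> set p \<and> (j, s) \<in> set p \<and> i \<notin> {j, u, s} \<and>
     (\<exists>e>0. linearisation a j (axis i 1) = e *\<^sub>R axis i 1)}"

end

theory Submission
  imports Defs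
begin

text \<open>
  Two observations carry the proof: a family of simplex systems can be solved in closed form, and
  the graph can be enlarged so that the system falls into this family where it matters.

  Dynamics. Give every edge the coefficient \<open>1\<close> and every non-edge the coefficient \<open>-1\<close>, and look at
  a trajectory whose nonzero coordinates form a transitive tournament \<open>i\<^sub>1, \<dots>, i\<^sub>n\<close>, with an edge from
  each vertex to all later ones. The coefficient matrix is antisymmetric there, so in the derivative
  of a tail sum \<open>s = x\<^sup>2(i\<^sub>r) + \<dots> + x\<^sup>2(i\<^sub>n)\<close> the interactions inside the tail cancel and those with the
  earlier vertices cancel against the term \<open>|x|\<^sup>2\<close>: the tail sums satisfy \<open>s' = 2 s (1 - s)\<close>,
  independently of each other. Every square \<open>x\<^sup>2(i\<^sub>r)\<close> is a difference of two consecutive tail sums,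
  which gives the trajectory explicitly (\<open>flow_solves\<close>). All nonzero tail sums tend to \<open>1\<close>, hence the
  trajectory converges to the equilibrium of the last vertex (\<open>flow_in_stable_manifold\<close>). A point
  of \<open>W\<^sup>u(\<xi>\<^sub>j)\<close> can only have nonzero coordinates at \<open>j\<close> and at the out-neighbours of \<open>j\<close>, because the
  other directions have negative eigenvalues at \<open>\<xi>\<^sub>j\<close> and coordinate hyperplanes are invariant
  (\<open>unstable_manifold_support\<close>). So the network is complete as soon as every out-neighbourhood is a
  transitive tournament (\<open>complete_network_unit_coeffs\<close>).

  Graph. Let \<open>(d, t)\<close> be the edge by which the shorter cycle \<open>p\<close> leaves the longer cycle \<open>q\<close>. Since \<open>p\<close>
  has at most two edges outside \<open>q\<close>, there are two cases (\<open>private_edges\<close>): either \<open>t\<close> lies on \<open>q\<close>, and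
  then \<open>(d, t)\<close> is the only edge of \<open>p\<close> outside \<open>q\<close>, since this chord of \<open>q\<close> already closes a second
  cycle; or \<open>p\<close> returns to \<open>q\<close> right after \<open>t\<close>. Add an edge to \<open>t\<close> from every vertex off \<open>p\<close>. Then every vertex has at most two out-neighbours, namely its successor on its cycle
  and possibly \<open>t\<close>, and two out-neighbours are always joined by an edge (\<open>out_tournament\<close>). No new
  edge starts on \<open>p\<close>, so the only edge that starts on \<open>p\<close> without belonging to \<open>p\<close> is the one from \<open>d\<close>
  along \<open>q\<close>, and it gives the only positive transverse eigenvalue.
\<close>

section \<open>Explicit solutions on transitive tournaments\<close>

text \<open>
  The square root of the factor by which the solution \<open>logistic S\<close> below falls short of the exponential
  growth \<open>S * exp (2 * t)\<close>.
\<close>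

definition damping :: "real \<Rightarrow> real \<Rightarrow> real" where
  "damping S t = 1 / sqrt (1 + S * (exp (2 * t) - 1))"

text \<open>
  The solution of \<open>s' = 2 s (1 - s)\<close> with \<open>s(0) = S\<close>.
\<close>

definition logistic :: "real \<Rightarrow> real \<Rightarrow> real" where
  "logistic S t = S * exp (2 * t) / (1 + S * (exp (2 * t) - 1))"

lemma DERIV_damping:
  assumes "1 + S * (exp (2 * t) - 1) > 0"
  shows "(damping S has_real_derivative - damping S t * logistic S t) (at t)"
  unfolding damping_def logistic_def using assms
  by (auto intro!: derivative_eq_intros simp: field_simps)

text \<open>
  The difference of two logistic solutions factorises; this is what makes the components of the flow
  products.
\<close>

lemma damping_sq:
  assumes "1 + S * (exp (2 * t) - 1) > 0" "1 + A * (exp (2 * t) - 1) > 0"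
  shows "(S - A) * (exp t)\<^sup>2 * (damping S t)\<^sup>2 * (damping A t)\<^sup>2 = logistic S t - logistic A t"
proof -
  have e: "(exp t)\<^sup>2 = exp (2 * t)" by (simp flip: exp_double)
  have "(S - A) * X / (P * Q) = S * X / P - A * X / Q"
    if "P = 1 + S * (X - 1)" "Q = 1 + A * (X - 1)" "P > 0" "Q > 0" for X P Q :: real
    using that(3,4) by (simp add: field_simps) (simp add: that(1,2) algebra_simps)
  from this[OF refl refl assms] show ?thesis
    using assms by (simp add: damping_def logistic_def power_divide e)
qed

lemma logistic_at_top:
  assumes "S > 0" shows "(logistic S \<longlongrightarrow> 1) at_top"
  unfolding logistic_def using assms by real_asymp

lemma logistic_at_bot:
  assumes "0 \<le> S" "S < 1" shows "(logistic S \<longlongrightarrow> 0) at_bot"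
proof -
  have "((\<lambda>t::real. exp (2 * t)) \<longlongrightarrow> 0) at_bot"
    by (rule filterlim_compose[OF exp_at_bot]) (auto intro: filterlim_tendsto_pos_mult_at_bot filterlim_ident)
  then have "(logistic S \<longlongrightarrow> S * 0 / (1 + S * (0 - 1))) at_bot"
    unfolding logistic_def using assms by (intro tendsto_intros) auto
  then show ?thesis by simp
qed

text \<open>
  If \<open>x\<close> lives on a tournament ordered along its edges, this is the tail sum of the initial squares that
  starts right after \<open>i\<close>.
\<close>

definition outmass :: "('v \<times> 'v) set \<Rightarrow> real ^ 'v::finite \<Rightarrow> 'v \<Rightarrow> real" where
  "outmass E x i = (\<Sum>k | (i, k) \<in> E. (x $ k)\<^sup>2)"

text \<open>
  With \<open>A\<close> the tail sum after \<open>i\<close> and \<open>B = (x $ i)\<^sup>2 + A\<close> the tail sum from \<open>i\<close>, the square of the \<open>i\<close>-th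
  component is \<open>logistic B t - logistic A t\<close>. The product form keeps the sign of \<open>x $ i\<close> and can be
  differentiated even where the component vanishes.
\<close>

definition flow :: "('v \<times> 'v) set \<Rightarrow> real ^ 'v::finite \<Rightarrow> real \<Rightarrow> real ^ 'v" where
  "flow E x t = (\<chi> i. x $ i * exp t * damping ((x $ i)\<^sup>2 + outmass E x i) t * damping (outmass E x i) t)"

definition unit_coeffs :: "('v \<times> 'v) set \<Rightarrow> 'v \<Rightarrow> 'v \<Rightarrow> real" where
  "unit_coeffs E j i = (if j = i then 0 else if (j, i) \<in> E then 1 else - 1)"

lemma norm_sq_vec: "(norm (x :: real ^ 'v::finite))\<^sup>2 = (\<Sum>i\<in>UNIV. (x $ i)\<^sup>2)"
  by (simp add: norm_vec_def L2_set_def sum_nonneg)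

lemma outmass_nonneg: "0 \<le> outmass E x i"
  by (simp add: outmass_def sum_nonneg)

lemma outmass_bound:
  assumes "asym E"
  shows "(x $ i)\<^sup>2 + outmass E x i \<le> (norm x)\<^sup>2"
proof -
  have "(x $ i)\<^sup>2 + outmass E x i = (\<Sum>k\<in>insert i {k. (i, k) \<in> E}. (x $ k)\<^sup>2)"
    using asymD[OF assms] by (subst sum.insert) (auto simp: outmass_def)
  also have "\<dots> \<le> (norm x)\<^sup>2" unfolding norm_sq_vec by (intro sum_mono2) auto
  finally show ?thesis .
qed

text \<open>
  Out-neighbours of \<open>i\<close> that precede \<open>i\<close> in the list are excluded by asymmetry, and those outside the
  list carry no mass.
\<close>

lemma outmass_sorted:
  assumes asym: "asym E" and sorted: "sorted_wrt (\<lambda>i k. (i, k) \<in> E) (us @ i # vs)"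
    and supp: "\<And>k. k \<notin> set (us @ i # vs) \<Longrightarrow> x $ k = 0"
  shows "outmass E x i = (\<Sum>k\<in>set vs. (x $ k)\<^sup>2)"
  unfolding outmass_def
proof (rule sum.mono_neutral_right)
  show "set vs \<subseteq> {k. (i, k) \<in> E}" using sorted by (auto simp: sorted_wrt_append)
  show "\<forall>k\<in>{k. (i, k) \<in> E} - set vs. (x $ k)\<^sup>2 = 0"
  proof
    fix k assume k: "k \<in> {k. (i, k) \<in> E} - set vs"
    then have "k \<notin> set us" "k \<noteq> i" using sorted asym by (auto simp: sorted_wrt_append dest: asymD)
    with k supp show "(x $ k)\<^sup>2 = 0" by simp
  qed
qed simp

text \<open>
  Starting inside the closed unit ball, the logistic solutions exist for all times; starting outside, they
  may blow up in the past but still exist for all nonnegative times.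
\<close>

lemma denominator_pos:
  fixes t :: real
  assumes "0 \<le> S" "S \<le> r" "t \<ge> 0 \<or> r \<le> 1"
  shows "1 + S * (exp (2 * t) - 1) > 0"
proof (cases "t \<ge> 0")
  case True
  then show ?thesis using assms by (intro add_pos_nonneg mult_nonneg_nonneg) auto
next
  case False
  then have "(1 - S) + S * exp (2 * t) > 0"
    using assms by (cases "S = 0") (auto intro: add_nonneg_pos)
  then show ?thesis by (simp add: algebra_simps)
qed

lemma flow_0: "flow E x 0 = x"
  by (simp add: flow_def damping_def)

context
  fixes E :: "('v::finite \<times> 'v) set" and x :: "real ^ 'v" and t :: real
  assumes asym: "asym E" and adm: "t \<ge> 0 \<or> (norm x)\<^sup>2 \<le> 1"
begin

lemma outmass_denominators:
  "1 + ((x $ i)\<^sup>2 + outmass E x i) * (exp (2 * t) - 1) > 0"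
  "1 + outmass E x i * (exp (2 * t) - 1) > 0"
proof -
  note b = outmass_bound[OF asym, of x i] outmass_nonneg[of E x i]
  show "1 + ((x $ i)\<^sup>2 + outmass E x i) * (exp (2 * t) - 1) > 0"
    by (rule denominator_pos[OF _ b(1) adm]) (use b in simp)
  show "1 + outmass E x i * (exp (2 * t) - 1) > 0"
    by (rule denominator_pos[OF b(2) _ adm]) (use b(1) in \<open>smt (verit) zero_le_power2\<close>)
qed

lemma flow_sq:
  "(flow E x t $ i)\<^sup>2 = logistic ((x $ i)\<^sup>2 + outmass E x i) t - logistic (outmass E x i) t"
  using damping_sq[OF outmass_denominators(1)[of i] outmass_denominators(2)[of i]]
  by (simp add: flow_def power_mult_distrib)

lemma flow_nonneg:
  assumes "x \<in> orthant"
  shows "0 \<le> flow E x t $ i"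
  using assms outmass_denominators[of i] by (auto simp: flow_def damping_def orthant_def)

text \<open>
  The squares telescope, because each of them is a difference of consecutive logistic tail sums.
\<close>

lemma flow_tail:
  assumes sorted: "sorted_wrt (\<lambda>i k. (i, k) \<in> E) (us @ vs)"
    and supp: "\<And>k. k \<notin> set (us @ vs) \<Longrightarrow> x $ k = 0"
  shows "(\<Sum>k\<in>set vs. (flow E x t $ k)\<^sup>2) = logistic (\<Sum>k\<in>set vs. (x $ k)\<^sup>2) t"
  using sorted supp
proof (induction vs arbitrary: us)
  case Nil
  then show ?case by (simp add: logistic_def)
next
  case (Cons i vs)
  have IH: "(\<Sum>k\<in>set vs. (flow E x t $ k)\<^sup>2) = logistic (\<Sum>k\<in>set vs. (x $ k)\<^sup>2) t"
    using Cons.IH[of "us @ [i]"] Cons.prems by simp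
  have i: "i \<notin> set vs" using Cons.prems asymD[OF asym, of i i] by (auto simp: sorted_wrt_append)
  with flow_sq[of i] IH outmass_sorted[OF asym Cons.prems] show ?case by simp
qed

text \<open>
  Vertices before \<open>i\<close> contribute \<open>-1\<close> through the norm and \<open>+1\<close> through their coefficient, vertices
  after \<open>i\<close> contribute \<open>-1\<close> twice. What remains are the tail sums from \<open>i\<close> and after \<open>i\<close>, each once.
\<close>

lemma flow_growth_rate:
  assumes sorted: "sorted_wrt (\<lambda>i k. (i, k) \<in> E) xs"
    and supp: "\<And>k. k \<notin> set xs \<Longrightarrow> x $ k = 0" and i: "i \<in> set xs"
  shows "1 - (norm (flow E x t))\<^sup>2 + (\<Sum>j\<in>UNIV. unit_coeffs E j i * (flow E x t $ j)\<^sup>2)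
      = 1 - logistic ((x $ i)\<^sup>2 + outmass E x i) t - logistic (outmass E x i) t"
proof -
  define y where "y = flow E x t"
  obtain us vs where xs: "xs = us @ i # vs" using split_list[OF i] by blast
  let ?s = "\<lambda>zs. \<Sum>k\<in>set zs. (y $ k)\<^sup>2"
  have y0: "y $ k = 0" if "k \<notin> set xs" for k
    using supp[OF that] by (simp add: y_def flow_def)
  have tail: "?s vs = logistic (\<Sum>k\<in>set vs. (x $ k)\<^sup>2) t"
    unfolding y_def using flow_tail[of "us @ [i]" vs] sorted supp xs by simp
  have iv: "i \<notin> set vs" "i \<notin> set us" "set us \<inter> set vs = {}"
    using sorted xs asym asymD[OF asym, of i i] by (auto simp: sorted_wrt_append dest: asymD)
  have out: "outmass E x i = (\<Sum>k\<in>set vs. (x $ k)\<^sup>2)"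
    using asym sorted supp unfolding xs by (rule outmass_sorted)
  have full: "(\<Sum>k\<in>UNIV. c k * (y $ k)\<^sup>2) = (\<Sum>k\<in>set us. c k * (y $ k)\<^sup>2) + c i * (y $ i)\<^sup>2
      + (\<Sum>k\<in>set vs. c k * (y $ k)\<^sup>2)" for c
  proof -
    have "(\<Sum>k\<in>UNIV. c k * (y $ k)\<^sup>2) = (\<Sum>k\<in>set us \<union> insert i (set vs). c k * (y $ k)\<^sup>2)"
      by (rule sum.mono_neutral_right) (use y0 xs in auto)
    also have "\<dots> = (\<Sum>k\<in>set us. c k * (y $ k)\<^sup>2) + (\<Sum>k\<in>insert i (set vs). c k * (y $ k)\<^sup>2)"
      using iv by (intro sum.union_disjoint) auto
    finally show ?thesis using iv by simp
  qed
  have "(\<Sum>k\<in>set us. unit_coeffs E k i * (y $ k)\<^sup>2) = ?s us"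
    using sorted xs iv by (intro sum.cong) (auto simp: unit_coeffs_def sorted_wrt_append)
  moreover have "(\<Sum>k\<in>set vs. unit_coeffs E k i * (y $ k)\<^sup>2) = - ?s vs"
    unfolding sum_negf[symmetric]
    using sorted xs iv asym by (intro sum.cong) (auto simp: unit_coeffs_def sorted_wrt_append dest: asymD)
  (* The diagonal coefficient is zero, so vertex i enters through the norm alone. *)
  ultimately have "(\<Sum>j\<in>UNIV. unit_coeffs E j i * (y $ j)\<^sup>2) = ?s us - ?s vs"
    unfolding full by (simp add: unit_coeffs_def)
  moreover have "(norm y)\<^sup>2 = ?s us + (y $ i)\<^sup>2 + ?s vs"
    unfolding norm_sq_vec using full[of "\<lambda>_. 1"] by simp
  moreover have "(y $ i)\<^sup>2 = logistic ((x $ i)\<^sup>2 + outmass E x i) t - logistic (outmass E x i) t"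
    unfolding y_def by (rule flow_sq)
  ultimately show ?thesis using tail out unfolding y_def by simp
qed

lemma flow_solves:
  assumes sorted: "sorted_wrt (\<lambda>i k. (i, k) \<in> E) xs"
    and supp: "\<And>k. k \<notin> set xs \<Longrightarrow> x $ k = 0"
  shows "(flow E x has_vector_derivative simplex_field (unit_coeffs E) (flow E x t)) (at t)"
proof -
  have comp: "((\<lambda>t. flow E x t $ i) has_real_derivative simplex_field (unit_coeffs E) (flow E x t) $ i) (at t)" for i
  proof (cases "i \<in> set xs")
    case True
    have "((\<lambda>t. flow E x t $ i) has_real_derivative
        flow E x t $ i * (1 - logistic ((x $ i)\<^sup>2 + outmass E x i) t - logistic (outmass E x i) t)) (at t)"
      unfolding flow_def vec_lambda_beta
      by (rule derivative_eq_intros DERIV_damping[OF outmass_denominators(1)] 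
           DERIV_damping[OF outmass_denominators(2)] refl)+ (simp add: algebra_simps)
    moreover have "1 - (norm (flow E x t))\<^sup>2 + (\<Sum>j\<in>UNIV. unit_coeffs E j i * (flow E x t $ j)\<^sup>2)
        = 1 - logistic ((x $ i)\<^sup>2 + outmass E x i) t - logistic (outmass E x i) t"
      using sorted supp True by (rule flow_growth_rate)
    ultimately show ?thesis by (simp only: simplex_field_def vec_lambda_beta)
  next
    case False
    then show ?thesis by (simp add: simplex_field_def flow_def supp)
  qed
  show ?thesis
    unfolding has_vector_derivative_def
  proof (rule iffD2[OF has_derivative_componentwise_within], rule ballI)
    fix b :: "real ^ 'v" assume "b \<in> Basis"
    then obtain k where b: "b = axis k 1" by (auto simp: Basis_vec_def)
    show "((\<lambda>s. flow E x s \<bullet> b) has_derivative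
        (\<lambda>h. (h *\<^sub>R simplex_field (unit_coeffs E) (flow E x t)) \<bullet> b)) (at t)"
      using comp[of k] unfolding b has_field_derivative_def
      by (simp add: inner_axis mult.commute[of _ "simplex_field _ _ $ _"])
  qed
qed

end



section \<open>Stable and unstable manifolds\<close>

text \<open>
  All tail sums up to the last vertex \<open>s\<close> are positive and tend to \<open>1\<close>. Their differences, the squares
  of the components other than \<open>s\<close>, therefore tend to \<open>0\<close>, while the last tail sum is the square of the
  component \<open>s\<close> itself.
\<close>

lemma flow_in_stable_manifold:
  assumes asym: "asym E" and sorted: "sorted_wrt (\<lambda>i k. (i, k) \<in> E) (us @ [s])"
    and supp: "\<And>k. x $ k \<noteq> 0 \<longleftrightarrow> k \<in> set (us @ [s])" and x: "x \<in> orthant"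
  shows "x \<in> stable_manifold (unit_coeffs E) s"
proof -
  let ?a = "unit_coeffs E"
  have adm: "0 \<le> t \<or> (norm x)\<^sup>2 \<le> 1" if "0 \<le> t" for t :: real using that by (rule disjI1)
  have zero: "x $ k = 0" if "k \<notin> set (us @ [s])" for k using supp[of k] that by blast
  have "(flow E x has_vector_derivative simplex_field ?a (flow E x t)) (at t within {0..})"
    if "t \<in> {0..}" for t
  proof -
    have "0 \<le> t" using that by simp
    from flow_solves[OF asym adm[OF this] sorted zero] show ?thesis
      by (rule has_vector_derivative_at_within)
  qed
  moreover have "(flow E x \<longlongrightarrow> xi s) at_top"
  proof (rule vec_tendstoI)
    fix i
    have pos: "0 < (x $ i)\<^sup>2" if "i \<in> set (us @ [s])" for i using supp that by simp
    have ev: "\<forall>\<^sub>F t in at_top. logistic ((x $ i)\<^sup>2 + outmass E x i) t - logistic (outmass E x i) t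
        = (flow E x t $ i)\<^sup>2" for i
      using eventually_ge_at_top[of 0] by eventually_elim (rule flow_sq[OF asym adm, symmetric])
    have sq: "((\<lambda>t. (flow E x t $ i)\<^sup>2) \<longlongrightarrow> (xi s $ i)\<^sup>2) at_top"
    proof (cases "x $ i = 0")
      case True
      moreover have "i \<noteq> s" using True supp by auto
      ultimately show ?thesis by (simp add: flow_def xi_def axis_def)
    next
      case False
      then consider "i = s" | "i \<in> set us" using supp[of i] by auto
      then show ?thesis
      proof cases
        assume i: "i = s"
        have "outmass E x s = (\<Sum>k\<in>set []. (x $ k)\<^sup>2)"
          by (rule outmass_sorted[OF asym sorted zero])
        then have "outmass E x s = 0" by simp
        then have "((\<lambda>t. logistic ((x $ s)\<^sup>2 + outmass E x s) t - logistic (outmass E x s) t) \<longlongrightarrow> 1) at_top"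
          using logistic_at_top[OF pos[of s]] by (simp add: logistic_def[of 0])
        from Lim_transform_eventually[OF this ev] show ?thesis by (simp add: i xi_def axis_def)
      next
        assume i: "i \<in> set us"
        then have edge: "(i, s) \<in> E" using sorted by (simp add: sorted_wrt_append)
        then have "i \<noteq> s" using asymD[OF asym edge] by blast
        have "0 < (x $ s)\<^sup>2" using pos by simp
        also have "\<dots> \<le> outmass E x i"
          unfolding outmass_def by (rule member_le_sum) (use edge in auto)
        finally have o: "0 < outmass E x i" .
        have "((\<lambda>t. logistic ((x $ i)\<^sup>2 + outmass E x i) t - logistic (outmass E x i) t) \<longlongrightarrow> 1 - 1) at_top"
          by (intro tendsto_diff logistic_at_top add_nonneg_pos zero_le_power2 o)
        from Lim_transform_eventually[OF this ev] show ?thesis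
          using \<open>i \<noteq> s\<close> by (simp add: xi_def axis_def)
      qed
    qed
    have "\<forall>\<^sub>F t in at_top. sqrt ((flow E x t $ i)\<^sup>2) = flow E x t $ i"
      using eventually_ge_at_top[of 0]
      by eventually_elim (rule real_sqrt_unique[OF refl flow_nonneg[OF asym adm x]])
    from Lim_transform_eventually[OF tendsto_real_sqrt[OF sq] this]
    show "((\<lambda>t. flow E x t $ i) \<longlongrightarrow> xi s $ i) at_top" by (simp add: xi_def axis_def)
  qed
  ultimately show ?thesis
    using x flow_0[of E x] unfolding stable_manifold_def mem_Collect_eq by (intro conjI exI[of _ "flow E x"] ballI)
qed

text \<open>
  In the coordinate plane of an edge the unit circle is invariant. The connection is the trajectory on
  it through the point with equal coordinates: the tail sums are \<open>logistic 1\<close>, which is constant, and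
  \<open>logistic (1/2)\<close>, which runs from \<open>0\<close> to \<open>1\<close>.
\<close>

lemma edge_connection:
  assumes asym: "asym E" and e: "(j, i) \<in> E"
  shows "connections (unit_coeffs E) j i \<inter> coordinate_plane j i \<noteq> {}"
proof -
  define x :: "real ^ 'a" where "x = (\<chi> k. if k = j \<or> k = i then sqrt (1/2) else 0)"
  have ji: "j \<noteq> i" using asymD[OF asym e] e by auto
  have x0: "x $ k = 0" if "k \<notin> {j, i}" for k using that by (auto simp: x_def)
  have sq: "(x $ j)\<^sup>2 = 1/2" "(x $ i)\<^sup>2 = 1/2" by (auto simp: x_def)
  have nn: "x $ k \<ge> 0" for k by (simp add: x_def)
  then have x: "x \<in> orthant" by (simp add: orthant_def)
  have "(norm x)\<^sup>2 = (\<Sum>k\<in>{j, i}. (x $ k)\<^sup>2)"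
    unfolding norm_sq_vec by (rule sum.mono_neutral_right) (use x0 in auto)
  then have adm: "0 \<le> t \<or> (norm x)\<^sup>2 \<le> 1" for t :: real using ji sq by simp
  have sorted: "sorted_wrt (\<lambda>i k. (i, k) \<in> E) [j, i]" using e by simp
  have supp: "k \<notin> set [j, i] \<Longrightarrow> x $ k = 0" for k using x0 by simp
  have "outmass E x j = (\<Sum>k\<in>set [i]. (x $ k)\<^sup>2)"
    by (rule outmass_sorted[OF asym, of "[]"]) (use e supp in auto)
  then have oj: "outmass E x j = 1/2" using sq by simp
  have "outmass E x i = (\<Sum>k\<in>set []. (x $ k)\<^sup>2)"
    by (rule outmass_sorted[OF asym, of "[j]"]) (use e supp in auto)
  then have oi: "outmass E x i = 0" by simp
  have "(flow E x has_vector_derivative simplex_field (unit_coeffs E) (flow E x t)) (at t within {..0})" for t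
    by (rule has_vector_derivative_at_within, rule flow_solves[OF asym adm sorted]) (use supp in blast)
  moreover have "(flow E x \<longlongrightarrow> xi j) at_bot"
  proof (rule vec_tendstoI)
    fix k
    have half: "(logistic (1/2) \<longlongrightarrow> 0) at_bot" by (rule logistic_at_bot) auto
    have one: "logistic 1 t = 1" for t by (simp add: logistic_def)
    have "((\<lambda>t. (flow E x t $ k)\<^sup>2) \<longlongrightarrow> (xi j $ k)\<^sup>2) at_bot"
    proof -
      consider "k = j" | "k = i" | "k \<noteq> j" "k \<noteq> i" by blast
      then show ?thesis
      proof cases
        case 1
        have "((\<lambda>t. 1 - logistic (1/2) t) \<longlongrightarrow> 1 - 0) at_bot" by (intro tendsto_diff half tendsto_const)
        then show ?thesis by (simp add: 1 flow_sq[OF asym adm] sq oj one xi_def)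
      next
        case 2
        then show ?thesis using half ji by (simp add: flow_sq[OF asym adm] sq oi logistic_def[of 0] xi_def axis_def)
      next
        case 3
        then show ?thesis by (simp add: flow_def x_def xi_def axis_def)
      qed
    qed
    from tendsto_real_sqrt[OF this]
    show "((\<lambda>t. flow E x t $ k) \<longlongrightarrow> xi j $ k) at_bot"
      using flow_nonneg[OF asym adm x] by (simp add: xi_def axis_def)
  qed
  ultimately have "x \<in> unstable_manifold (unit_coeffs E) j"
    using x flow_0[of E x] unfolding unstable_manifold_def mem_Collect_eq
    by (intro conjI exI[of _ "flow E x"] ballI)
  moreover have "x \<in> stable_manifold (unit_coeffs E) i"
  proof (rule flow_in_stable_manifold[OF asym _ _ x])
    show "sorted_wrt (\<lambda>i k. (i, k) \<in> E) ([j] @ [i])" using e by simp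
  qed (auto simp: x_def)
  moreover have "x \<in> coordinate_plane j i" by (simp add: coordinate_plane_def x_def)
  ultimately show ?thesis unfolding connections_def by blast
qed

text \<open>
  If \<open>\<bar>g\<bar> \<le> M\<close> on \<open>[T, 0]\<close>, then \<open>(u t)\<^sup>2 * exp (2 * M * t)\<close> is nondecreasing and
  \<open>(u t)\<^sup>2 * exp (- 2 * M * t)\<close> is nonincreasing there. In the simplex system every coordinate satisfies
  such an equation along a trajectory.
\<close>

lemma linear_ode_zero:
  fixes u g :: "real \<Rightarrow> real"
  assumes der: "\<And>t. t < 0 \<Longrightarrow> (u has_real_derivative u t * g t) (at t)"
    and contu: "continuous_on {..0} u" and contg: "continuous_on {..0} g" and T: "T \<le> 0"
  shows "u T = 0 \<longleftrightarrow> u 0 = 0"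
proof -
  have "compact (g ` {T..0})"
    by (rule compact_continuous_image) (auto intro: continuous_on_subset[OF contg])
  then obtain M where M: "\<And>t. t \<in> {T..0} \<Longrightarrow> \<bar>g t\<bar> \<le> M"
    using compact_imp_bounded bounded_iff by (metis image_eqI real_norm_def)
  have d: "((\<lambda>t. (u t)\<^sup>2 * exp (c * t)) has_real_derivative (u t)\<^sup>2 * exp (c * t) * (2 * g t + c)) (at t)"
    if "t < 0" for t c
    by (rule derivative_eq_intros der[OF that] refl)+ (simp add: power2_eq_square algebra_simps)
  have cont: "continuous_on {T..0} (\<lambda>t. (u t)\<^sup>2 * exp (c * t))" for c
    by (intro continuous_intros continuous_on_subset[OF contu]) auto
  have "(u T)\<^sup>2 * exp (2 * M * T) \<le> (u 0)\<^sup>2 * exp (2 * M * 0)"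
  proof (rule DERIV_nonneg_imp_increasing_open[OF T _ cont])
    fix t assume "T < t" "t < 0"
    then show "\<exists>y. ((\<lambda>t. (u t)\<^sup>2 * exp (2 * M * t)) has_real_derivative y) (at t) \<and> 0 \<le> y"
      using d[of t "2 * M"] M[of t] by (intro exI conjI) (assumption, auto intro!: mult_nonneg_nonneg)
  qed
  moreover have "(u 0)\<^sup>2 * exp (- 2 * M * 0) \<le> (u T)\<^sup>2 * exp (- 2 * M * T)"
  proof (rule DERIV_nonpos_imp_decreasing_open[OF T _ cont])
    fix t assume "T < t" "t < 0"
    then show "\<exists>y. ((\<lambda>t. (u t)\<^sup>2 * exp (- 2 * M * t)) has_real_derivative y) (at t) \<and> y \<le> 0"
      using d[of t "- 2 * M"] M[of t] by (intro exI conjI) (assumption, auto intro!: mult_nonneg_nonpos)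
  qed
  ultimately show ?thesis by (auto simp: mult_le_0_iff)
qed

text \<open>
  In the distant past \<open>u\<^sup>2\<close> is nonincreasing in time and tends to \<open>0\<close> at \<open>-\<infinity>\<close>, hence it vanishes there,
  and then it vanishes at all later times.
\<close>

lemma linear_ode_contracting:
  fixes u g :: "real \<Rightarrow> real"
  assumes der: "\<And>t. t < 0 \<Longrightarrow> (u has_real_derivative u t * g t) (at t)"
    and contu: "continuous_on {..0} u" and contg: "continuous_on {..0} g"
    and lim: "(u \<longlongrightarrow> 0) at_bot" and neg: "\<forall>\<^sub>F t in at_bot. g t \<le> 0"
  shows "u 0 = 0"
proof -
  obtain T where T: "T \<le> 0" "\<And>t. t \<le> T \<Longrightarrow> g t \<le> 0"
    using neg unfolding eventually_at_bot_linorder by (metis min.cobounded1 min.cobounded2 order_trans)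
  have "(u T)\<^sup>2 \<le> (u s)\<^sup>2" if "s \<le> T" for s
  proof (rule DERIV_nonpos_imp_decreasing_open[OF that])
    fix t assume "s < t" "t < T"
    then have "((\<lambda>t. (u t)\<^sup>2) has_real_derivative 2 * (u t)\<^sup>2 * g t) (at t)" "g t \<le> 0"
      using der[of t] T by (auto intro!: derivative_eq_intros simp: power2_eq_square)
    then show "\<exists>y. ((\<lambda>t. (u t)\<^sup>2) has_real_derivative y) (at t) \<and> y \<le> 0"
      by (intro exI conjI) (assumption, rule mult_nonneg_nonpos, auto)
  next
    show "continuous_on {s..T} (\<lambda>t. (u t)\<^sup>2)"
      by (intro continuous_intros continuous_on_subset[OF contu]) (use T in auto)
  qed
  moreover have lim2: "((\<lambda>t. (u t)\<^sup>2) \<longlongrightarrow> 0) at_bot" using tendsto_power[OF lim, of 2] by simp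
  ultimately have "(u T)\<^sup>2 \<le> 0"
    by (intro tendsto_lowerbound[OF lim2]) (auto simp: eventually_at_bot_linorder intro: exI[of _ T])
  then have "u T = 0" by simp
  then show ?thesis using linear_ode_zero[OF der contu contg T(1)] by simp
qed

text \<open>
  Along a trajectory each coordinate has a growth rate that tends to the eigenvalue \<open>a j i\<close> in the
  past, so a coordinate with negative eigenvalue can tend to \<open>0\<close> in the past only by being \<open>0\<close>.
\<close>

lemma unstable_manifold_support:
  assumes x0: "x0 \<in> unstable_manifold a j" and ajj: "a j j = 0"
  shows "x0 $ j \<noteq> 0" and "a j i < 0 \<Longrightarrow> x0 $ i = 0"
proof -
  obtain x where start: "x 0 = x0" and lim: "(x \<longlongrightarrow> xi j) at_bot"
    and sol: "\<And>t. t \<in> {..0} \<Longrightarrow> (x has_vector_derivative simplex_field a (x t)) (at t within {..0})"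
    using x0 unfolding unstable_manifold_def mem_Collect_eq by (elim conjE exE) metis
  define g where "g i t = 1 - (norm (x t))\<^sup>2 + (\<Sum>k\<in>UNIV. a k i * (x t $ k)\<^sup>2)" for i t
  have der: "((\<lambda>t. x t $ i) has_real_derivative x t $ i * g i t) (at t)" if "t < 0" for i t
  proof -
    have "at t within {..0} = at t" by (rule at_within_interior) (use that in simp)
    then have "(x has_vector_derivative simplex_field a (x t)) (at t)"
      using sol[of t] that by simp
    from bounded_linear.has_vector_derivative[OF bounded_linear_vec_nth this, of i]
    show ?thesis
      by (simp add: has_real_derivative_iff_has_vector_derivative simplex_field_def g_def)
  qed
  have cx: "continuous_on {..0} x"
    unfolding continuous_on_eq_continuous_within
    by (intro ballI has_vector_derivative_continuous[OF sol])
  have contx: "continuous_on {..0} (\<lambda>t. x t $ i)" for i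
    by (rule bounded_linear.continuous_on[OF bounded_linear_vec_nth cx])
  have contg: "continuous_on {..0} (g i)" for i
    unfolding g_def
    by (intro continuous_on_add continuous_on_diff continuous_on_sum continuous_on_mult
        continuous_on_power continuous_on_norm continuous_on_const contx cx)
  note cont = contx contg
  have limi: "((\<lambda>t. x t $ i) \<longlongrightarrow> xi j $ i) at_bot" for i
    by (rule tendsto_vec_nth[OF lim])
  show "x0 $ j \<noteq> 0"
  proof
    assume zero: "x0 $ j = 0"
    have "x t $ j = 0" if "t \<le> 0" for t
      using linear_ode_zero[OF der cont that] zero start by simp
    then have "((\<lambda>t. x t $ j) \<longlongrightarrow> 0) at_bot"
      by (intro tendsto_eventually) (auto simp: eventually_at_bot_linorder)
    from tendsto_unique[OF _ limi[of j] this] show False by (simp add: xi_def)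
  qed
  assume neg: "a j i < 0"
  then have ij: "i \<noteq> j" using ajj by auto
  have "(g i \<longlongrightarrow> 1 - (norm (xi j))\<^sup>2 + (\<Sum>k\<in>UNIV. a k i * (xi j $ k)\<^sup>2)) at_bot"
    unfolding g_def
    by (intro tendsto_add tendsto_diff tendsto_sum tendsto_mult tendsto_power tendsto_norm
        tendsto_const lim limi)
  moreover have "(\<Sum>k\<in>UNIV. a k i * (xi j $ k)\<^sup>2) = a j i"
  proof -
    have "a k i * (xi j $ k)\<^sup>2 = (if k = j then a j i else 0)" for k by (simp add: xi_def axis_def)
    then show ?thesis by simp
  qed
  ultimately have "(g i \<longlongrightarrow> a j i) at_bot" by (simp add: xi_def)
  then have "\<forall>\<^sub>F t in at_bot. g i t < 0" using neg by (rule order_tendstoD)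
  then have "\<forall>\<^sub>F t in at_bot. g i t \<le> 0" by (rule eventually_mono) simp
  moreover have "((\<lambda>t. x t $ i) \<longlongrightarrow> 0) at_bot" using limi[of i] ij by (simp add: xi_def axis_def)
  ultimately have "x 0 $ i = 0" by (intro linear_ode_contracting[OF der cont])
  then show "x0 $ i = 0" by (simp add: start)
qed

text \<open>
  The nonzero coordinates of a point of \<open>W\<^sup>u(\<xi>\<^sub>j)\<close> form a nonempty part of the transitive tournament
  consisting of \<open>j\<close> and its out-neighbours, so its trajectory is one of the explicit solutions.
\<close>

lemma complete_network_unit_coeffs:
  assumes asym: "asym E"
    and out: "\<And>j. \<exists>ks. sorted_wrt (\<lambda>i k. (i, k) \<in> E) ks \<and> set ks = {k. (j, k) \<in> E}"
  shows "complete_network (unit_coeffs E)"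
  unfolding complete_network_def
proof (intro allI subsetI)
  fix j x assume x: "x \<in> unstable_manifold (unit_coeffs E) j"
  then have orth: "x \<in> orthant" by (simp add: unstable_manifold_def)
  obtain ks where ks: "sorted_wrt (\<lambda>i k. (i, k) \<in> E) ks" "set ks = {k. (j, k) \<in> E}"
    using out by blast
  define zs where "zs = filter (\<lambda>k. x $ k \<noteq> 0) (j # ks)"
  have zero: "x $ k = 0" if "k \<noteq> j" "(j, k) \<notin> E" for k
    by (rule unstable_manifold_support(2)[OF x]) (use that in \<open>simp_all add: unit_coeffs_def\<close>)
  have supp: "x $ k \<noteq> 0 \<longleftrightarrow> k \<in> set zs" for k
    using zero[of k] by (auto simp: zs_def ks(2))
  have "zs \<noteq> []" using unstable_manifold_support(1)[OF x] by (simp add: zs_def unit_coeffs_def)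
  then obtain us s where zs: "zs = us @ [s]" by (metis rev_exhaust)
  have sorted: "sorted_wrt (\<lambda>i k. (i, k) \<in> E) zs"
    unfolding zs_def by (rule sorted_wrt_filter) (simp add: ks)
  have "x \<in> stable_manifold (unit_coeffs E) s"
    by (rule flow_in_stable_manifold[OF asym sorted[unfolded zs] supp[unfolded zs] orth])
  then show "x \<in> network (unit_coeffs E)" using x by (auto simp: network_def connections_def)
qed



section \<open>Cycles as sets of pairs\<close>

text \<open>
  A directed cycle without reference to an ambient graph. All cycles of a graph on the whole vertex
  type are of this form, whatever the other edges are.
\<close>

definition cyclic_walk :: "('v \<times> 'v) list \<Rightarrow> bool" where
  "cyclic_walk r \<longleftrightarrow> r \<noteq> [] \<and> distinct (map snd r) \<and> (\<exists>u. pcas u r u)"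

lemma pcas_verts: "pcas u r v \<Longrightarrow> map fst r @ [v] = u # map snd r"
  by (induction r arbitrary: u) auto

lemma cycle_iff_cyclic_walk:
  assumes "pverts G = UNIV"
  shows "pre_digraph.cycle (with_proj G) r \<longleftrightarrow> cyclic_walk r \<and> set r \<subseteq> parcs G"
proof -
  have "pcas u r v \<Longrightarrow> pawalk_verts u r = u # map snd r" for u v
    by (induction r arbitrary: u) auto
  then show ?thesis
    using assms unfolding pre_digraph.cycle_def pre_digraph.awalk_def cyclic_walk_def
    by (auto simp: cas_with_proj_eq awalk_verts_with_proj_eq)
qed

text \<open>
  The sources of the edges are the targets shifted by one position, hence a permutation of them.
\<close>

lemma cyclic_walk_fst:
  assumes "cyclic_walk r"
  shows "distinct (map fst r)" "fst ` set r = snd ` set r"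
proof -
  obtain u where "pcas u r u" "distinct (map snd r)" using assms by (auto simp: cyclic_walk_def)
  then have "mset (map fst r @ [u]) = mset (u # map snd r)" by (simp only: pcas_verts)
  then have eq: "mset (map fst r) = mset (map snd r)" by simp
  show "distinct (map fst r)" using mset_eq_imp_distinct_iff[OF eq] \<open>distinct (map snd r)\<close> by simp
  show "fst ` set r = snd ` set r" using mset_eq_setD[OF eq] by simp
qed

lemma cyclic_walk_unique:
  assumes "cyclic_walk r"
  shows "(x, y) \<in> set r \<Longrightarrow> (x, z) \<in> set r \<Longrightarrow> y = z"
    and "(y, x) \<in> set r \<Longrightarrow> (z, x) \<in> set r \<Longrightarrow> y = z"
proof -
  have "inj_on fst (set r)" "inj_on snd (set r)"
    using cyclic_walk_fst(1)[OF assms] assms by (auto simp: cyclic_walk_def distinct_map)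
  then show "(x, y) \<in> set r \<Longrightarrow> (x, z) \<in> set r \<Longrightarrow> y = z"
    "(y, x) \<in> set r \<Longrightarrow> (z, x) \<in> set r \<Longrightarrow> y = z"
    using inj_onD[of fst "set r" "(x, y)" "(x, z)"] inj_onD[of snd "set r" "(y, x)" "(z, x)"] by simp_all
qed

lemma cyclic_walk_length:
  assumes "cyclic_walk r"
  shows "length r = card (set r)"
  using assms by (simp add: cyclic_walk_def distinct_card distinct_map)

lemma cyclic_walk_successor:
  assumes "cyclic_walk r" "(x, y) \<in> set r"
  obtains z where "(y, z) \<in> set r"
proof -
  have "y \<in> fst ` set r" using assms cyclic_walk_fst(2)[OF assms(1)] by force
  then show ?thesis using that by auto
qed

lemma pcas_append: "pcas u (A @ B) v \<longleftrightarrow> (\<exists>w. pcas u A w \<and> pcas w B v)"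
  by (induction A arbitrary: u) auto

lemma pcas_rtrancl: "pcas u r v \<Longrightarrow> set r \<subseteq> R \<Longrightarrow> (u, v) \<in> R\<^sup>*"
  by (induction r arbitrary: u) (auto intro: converse_rtrancl_into_rtrancl)

lemma cyclic_walk_reach:
  assumes "cyclic_walk r" "x \<in> fst ` set r" "y \<in> fst ` set r"
  shows "(x, y) \<in> (set r)\<^sup>*"
proof -
  obtain u where u: "pcas u r u" using assms(1) by (auto simp: cyclic_walk_def)
  have "(u, z) \<in> (set r)\<^sup>* \<and> (z, u) \<in> (set r)\<^sup>*" if "z \<in> fst ` set r" for z
  proof -
    from that obtain e where "e \<in> set r" and z: "z = fst e" by blast
    then obtain A B where r: "r = A @ e # B" by (meson split_list)
    then have "pcas u A z" "pcas z (e # B) u" using u z by (auto simp: pcas_append)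
    then show ?thesis using r pcas_rtrancl[of u A z "set r"] pcas_rtrancl[of z "e # B" u "set r"] by fastforce
  qed
  with assms(2,3) show ?thesis by (meson rtrancl_trans)
qed

lemma cyclic_walk_closed:
  assumes "cyclic_walk r" "x \<in> fst ` set r" "x \<in> S"
    and "\<And>u v. (u, v) \<in> set r \<Longrightarrow> u \<in> S \<Longrightarrow> v \<in> S"
  shows "fst ` set r \<subseteq> S"
proof
  fix y assume "y \<in> fst ` set r"
  with assms(1,2) have "(x, y) \<in> (set r)\<^sup>*" by (rule cyclic_walk_reach)
  then show "y \<in> S" by induction (use assms in auto)
qed

text \<open>
  The vertices of \<open>p\<close> are closed under the successor map of \<open>q\<close>, because that map agrees with the
  successor map of \<open>p\<close> there; hence they exhaust \<open>q\<close>.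
\<close>

lemma cyclic_walk_eqI:
  assumes p: "cyclic_walk p" and q: "cyclic_walk q" and sub: "set p \<subseteq> set q"
  shows "set p = set q"
proof -
  obtain x y where xy: "(x, y) \<in> set p" using p by (cases p) (auto simp: cyclic_walk_def)
  have "fst ` set q \<subseteq> fst ` set p"
  proof (rule cyclic_walk_closed[OF q])
    fix u v assume uv: "(u, v) \<in> set q" "u \<in> fst ` set p"
    then obtain w where "(u, w) \<in> set p" by auto
    moreover from this have "v = w" using cyclic_walk_unique(1)[OF q uv(1)] sub by blast
    ultimately obtain z where "(v, z) \<in> set p" using cyclic_walk_successor[OF p] by blast
    then show "v \<in> fst ` set p" by force
  next
    show "x \<in> fst ` set q" "x \<in> fst ` set p" using xy sub by force+
  qed
  moreover have "(u, v) \<in> set p" if uv: "(u, v) \<in> set q" "u \<in> fst ` set p" for u v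
  proof -
    obtain w where w: "(u, w) \<in> set p" using uv by auto
    then have "v = w" using cyclic_walk_unique(1)[OF q uv(1)] sub by blast
    with w show ?thesis by simp
  qed
  ultimately have "set q \<subseteq> set p" by force
  with sub show ?thesis by blast
qed

lemma rtrancl_path:
  assumes "(x, y) \<in> R\<^sup>*"
  obtains P where "pcas x P y" "set P \<subseteq> R" "distinct (x # map snd P)"
proof -
  let ?H = "\<lparr> pverts = UNIV, parcs = R \<rparr>"
  interpret H: pair_wf_digraph ?H by unfold_locales auto
  have "(x, y) \<in> rtrancl_on UNIV R"
    by (rule rtrancl_consistent_rtrancl_on) (use assms in simp_all)
  then have "reachable (with_proj ?H) x y" by (simp add: reachable_def)
  then obtain P where P: "H.apath x P y" using H.reachable_apath by blast
  then have c: "pcas x P y" "set P \<subseteq> R" "distinct (pawalk_verts x P)"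
    by (auto simp: H.apath_def H.awalk_def)
  have "pcas a P b \<Longrightarrow> pawalk_verts a P = a # map snd P" for a b
    by (induction P arbitrary: a) auto
  with c that show ?thesis by metis
qed

text \<open>
  Return from \<open>t\<close> to \<open>d\<close> along the given cycle.
\<close>

lemma chord_cyclic_walk:
  assumes q: "cyclic_walk q" and d: "d \<in> fst ` set q" and t: "t \<in> fst ` set q"
  obtains r where "cyclic_walk r" "(d, t) \<in> set r" "set r \<subseteq> insert (d, t) (set q)"
proof -
  obtain P where "pcas t P d" "set P \<subseteq> set q" "distinct (t # map snd P)"
    using rtrancl_path[OF cyclic_walk_reach[OF q t d]] .
  then show ?thesis by (intro that[of "(d, t) # P"]) (auto simp: cyclic_walk_def)
qed

section \<open>Two cycles, the shorter with at most two private edges\<close>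

locale two_cycles =
  fixes p q :: "('v \<times> 'v) list"
  assumes p: "cyclic_walk p" and q: "cyclic_walk q" and neq: "set p \<noteq> set q"
    and only: "\<And>r. cyclic_walk r \<Longrightarrow> set r \<subseteq> set p \<union> set q \<Longrightarrow> set r = set p \<or> set r = set q"
begin

text \<open>
  The chord \<open>(d, t)\<close> of \<open>q\<close> closes a cycle made of itself and edges of \<open>q\<close>. This cycle is not \<open>q\<close>, so it
  is \<open>p\<close>.
\<close>

lemma chord:
  assumes "(d, t) \<in> set p" "(d, t) \<notin> set q" "d \<in> fst ` set q" "t \<in> fst ` set q"
  shows "set p \<subseteq> insert (d, t) (set q)"
proof -
  obtain r where r: "cyclic_walk r" "(d, t) \<in> set r" "set r \<subseteq> insert (d, t) (set q)"
    using chord_cyclic_walk[OF q assms(3,4)] .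
  with only[of r] assms show ?thesis by auto
qed

lemma swap: "two_cycles q p"
  using p q neq only by unfold_locales blast+

end

locale short_cycle = two_cycles +
  assumes overlap: "set p \<inter> set q \<noteq> {}"
    and short: "length p \<le> card (set p \<inter> set q) + 2" and le: "length p \<le> length q"
    and loopfree: "(x, x) \<notin> set p \<union> set q"
begin

lemma card_private: "card (set p - set q) + card (set p \<inter> set q) = length p"
  by (simp add: cyclic_walk_length[OF p] card_Diff_subset_Int card_mono)

text \<open>
  An edge of one cycle is called private if it does not belong to the other one. If no private edge
  of \<open>p\<close> started on \<open>q\<close>, then \<open>p\<close>, which meets \<open>q\<close>, could never leave it and would coincide with it.
\<close>

lemma private_edge: "\<exists>d t. (d, t) \<in> set p \<and> (d, t) \<notin> set q \<and> d \<in> fst ` set q"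
proof (rule ccontr)
  assume none: "\<not> ?thesis"
  obtain x y where xy: "(x, y) \<in> set p" "(x, y) \<in> set q" using overlap by auto
  have "fst ` set p \<subseteq> fst ` set q"
  proof (rule cyclic_walk_closed[OF p])
    fix u v assume "(u, v) \<in> set p" "u \<in> fst ` set q"
    then have "(u, v) \<in> set q" using none by blast
    then show "v \<in> fst ` set q" using cyclic_walk_successor[OF q] by (metis fst_conv image_eqI)
  qed (use xy in force)+
  then have "set p \<subseteq> set q" using none by force
  then show False using cyclic_walk_eqI[OF p q] neq by blast
qed

end

text \<open>
  Here \<open>d\<close> will turn out to be the distribution vertex, and \<open>t\<close> is its successor on the shorter cycle.
\<close>

locale branching = short_cycle +
  fixes d t :: 'a
  assumes dt: "(d, t) \<in> set p" "(d, t) \<notin> set q" "d \<in> fst ` set q"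
begin

text \<open>
  If \<open>t\<close> lies on \<open>q\<close>, then \<open>(d, t)\<close> is a chord of \<open>q\<close> and there is no other private edge. If not, the
  edge of \<open>p\<close> that leaves \<open>t\<close> is the second private edge, and there is no room for a third.
\<close>

lemma private_edges:
  assumes "(u, v) \<in> set p" "(u, v) \<notin> set q"
  shows "(u = d \<and> v = t) \<or> (u = t \<and> t \<notin> fst ` set q)"
proof (cases "t \<in> fst ` set q")
  case True
  then show ?thesis using chord[OF dt True] assms by auto
next
  case False
  obtain c where c: "(t, c) \<in> set p" using cyclic_walk_successor[OF p dt(1)] .
  have "(t, c) \<notin> set q" using False by force
  have "t \<noteq> d" using False dt(3) by metis
  have "{(d, t), (t, c), (u, v)} \<subseteq> set p - set q" using c dt assms \<open>(t, c) \<notin> set q\<close> by auto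
  then have "card {(d, t), (t, c), (u, v)} \<le> card (set p - set q)" by (intro card_mono) auto
  also have "\<dots> \<le> 2" using card_private short by linarith
  finally have "(u, v) = (d, t) \<or> (u, v) = (t, c)"
    using \<open>t \<noteq> d\<close> by (auto simp: card_insert_if split: if_splits)
  then show ?thesis using False by auto
qed

text \<open>
  Otherwise \<open>(d, s)\<close> would be a chord of \<open>p\<close>, and \<open>q\<close> would have a single private edge. As \<open>q\<close> is not
  shorter than \<open>p\<close>, also \<open>p\<close> would have a single private edge, so \<open>t\<close> would lie on \<open>q\<close>. The edge of \<open>q\<close> into
  \<open>t\<close> does not start at \<open>d\<close> and would therefore be common to both cycles, whereas \<open>p\<close> enters \<open>t\<close> from
  \<open>d\<close>.
\<close>

lemma d_successor_private:
  assumes s: "(d, s) \<in> set q"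
  shows "s \<notin> fst ` set p"
proof
  assume sp: "s \<in> fst ` set p"
  interpret swap: two_cycles q p by (rule swap)
  have "(d, s) \<notin> set p" using cyclic_walk_unique(1)[OF p dt(1)] dt(2) s by blast
  then have sub: "set q \<subseteq> insert (d, s) (set p)" using swap.chord[OF s] dt(1) sp by force
  then have "set q = insert (d, s) (set p \<inter> set q)" using s by auto
  then have "length q = card (set p \<inter> set q) + 1"
    using \<open>(d, s) \<notin> set p\<close> unfolding cyclic_walk_length[OF q]
    by (metis Int_iff Suc_eq_plus1 card_insert_disjoint finite_Int finite_set)
  (* The number of private edges of p cannot exceed that of q, because p is not longer. *)
  then have "card (set p - set q) \<le> 1" using card_private le by linarith
  then have only_dt: "e = (d, t)" if "e \<in> set p" "e \<notin> set q" for e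
    using that dt by (auto simp: card_le_Suc0_iff_eq)
  obtain c where c: "(t, c) \<in> set p" using cyclic_walk_successor[OF p dt(1)] .
  have "t \<in> fst ` set q"
    using only_dt[OF c] c loopfree[of t] dt by force
  then obtain w where w: "(w, t) \<in> set q" using cyclic_walk_fst(2)[OF q] by auto
  then have "w \<noteq> d" using dt by auto
  then have "(w, t) \<in> set p" using sub w by auto
  then show False using cyclic_walk_unique(2)[OF p dt(1)] \<open>w \<noteq> d\<close> by blast
qed

text \<open>
  The vertices off \<open>p\<close> are the private vertices of \<open>q\<close>. Sending them all to \<open>t\<close> makes every consecutive
  pair of them span a transitive triangle with \<open>t\<close>, starting from the triangle at \<open>d\<close>.
\<close>

definition augmented :: "('a \<times> 'a) set" where
  "augmented = set p \<union> set q \<union> {(v, t) | v. v \<notin> fst ` set p}"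

lemma t_in_p: "t \<in> fst ` set p"
  using dt(1) cyclic_walk_fst(2)[OF p] by force

lemma out_p:
  assumes j: "(j, s) \<in> set p" and k: "(j, k) \<in> augmented"
  shows "k = s \<or> (j = d \<and> (d, k) \<in> set q)"
proof -
  have "j \<in> fst ` set p" using j by force
  then consider "(j, k) \<in> set p" | "(j, k) \<in> set q" using k by (auto simp: augmented_def)
  then show ?thesis
  proof cases
    case 1
    then show ?thesis using cyclic_walk_unique(1)[OF p j] by blast
  next
    case 2
    show ?thesis
    proof (cases "(j, s) \<in> set q")
      case True
      then show ?thesis using cyclic_walk_unique(1)[OF q 2] by blast
    next
      case False
      then show ?thesis using private_edges[OF j] 2 by force
    qed
  qed
qed

text \<open>
  The cycle \<open>q\<close> enters \<open>p\<close> either at \<open>t\<close> or, if \<open>t\<close> is not on \<open>q\<close>, at the successor of \<open>t\<close>: at any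
  other vertex of \<open>p\<close> the edge of \<open>p\<close> arriving there belongs to \<open>q\<close> as well.
\<close>

lemma into_p:
  assumes "(j, s) \<in> set q" "j \<notin> fst ` set p" "s \<in> fst ` set p" "s \<noteq> t"
  shows "(t, s) \<in> set p"
proof -
  obtain u where u: "(u, s) \<in> set p" using assms(3) cyclic_walk_fst(2)[OF p] by auto
  have "(u, s) \<notin> set q" using cyclic_walk_unique(2)[OF q assms(1)] assms(2) u by force
  then show ?thesis using private_edges[OF u] u assms(4) by auto
qed

lemma not_back_from_t:
  assumes "v \<notin> fst ` set p"
  shows "(t, v) \<notin> augmented"
proof
  assume tv: "(t, v) \<in> augmented"
  obtain c where c: "(t, c) \<in> set p" using t_in_p by auto
  obtain z where "(c, z) \<in> set p" using cyclic_walk_successor[OF p c] .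
  then have "v \<noteq> c" using assms by force
  with out_p[OF c tv] have "t = d" by blast
  then show False using dt(1) loopfree[of d] by simp
qed

lemma branch_unique:
  assumes "(v, w) \<in> set p \<union> set q" "(v, w') \<in> set p \<union> set q" "w \<noteq> w'"
  shows "v = d"
proof (rule ccontr)
  assume vd: "v \<noteq> d"
  show False
  proof (cases "v \<in> fst ` set p")
    case True
    then obtain s where s: "(v, s) \<in> set p" by auto
    have "(v, w) \<in> augmented" "(v, w') \<in> augmented" using assms unfolding augmented_def by blast+
    then have "w = s" "w' = s" using out_p[OF s] vd by blast+
    then show False using assms by simp
  next
    case False
    then have "(v, x) \<notin> set p" for x by force
    then show False using cyclic_walk_unique(1)[OF q] assms by blast
  qed
qed

text \<open>
  A new edge ends in \<open>t\<close>, and \<open>t\<close> sends no edge off \<open>p\<close>.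
\<close>

lemma asym_augmented:
  assumes no2: "\<And>x y. (x, y) \<in> set p \<union> set q \<Longrightarrow> (y, x) \<notin> set p \<union> set q"
  shows "asym augmented"
proof (rule asymI, rule notI)
  fix x y assume xy: "(x, y) \<in> augmented" and yx: "(y, x) \<in> augmented"
  have new: "(a, b) \<in> set p \<union> set q" if "(a, b) \<in> augmented" "(b, a) \<in> augmented" for a b
  proof (rule ccontr)
    assume "(a, b) \<notin> set p \<union> set q"
    with that(1) have "b = t" "a \<notin> fst ` set p" unfolding augmented_def by blast+
    with that(2) not_back_from_t show False by blast
  qed
  show False using no2[OF new[OF xy yx]] new[OF yx xy] by blast
qed

text \<open>
  There is a choice only at \<open>d\<close>, where the successor on \<open>q\<close> is off \<open>p\<close> and hence joined to \<open>t\<close>, and at the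
  vertices off \<open>p\<close>. For the latter the orientation of the triangle depends on the successor on \<open>q\<close>: off
  \<open>p\<close> it points to \<open>t\<close>, but where \<open>q\<close> re-enters \<open>p\<close> behind \<open>t\<close> the edge comes from \<open>t\<close>.
\<close>

lemma out_tournament:
  assumes cover: "fst ` set p \<union> fst ` set q = UNIV"
  shows "\<exists>ks. sorted_wrt (\<lambda>i k. (i, k) \<in> augmented) ks \<and> set ks = {k. (j, k) \<in> augmented}"
proof (cases "j \<in> fst ` set p")
  case True
  then obtain s where s: "(j, s) \<in> set p" by auto
  show ?thesis
  proof (cases "j = d")
    case True
    obtain k where k: "(d, k) \<in> set q" using dt(3) by auto
    have "(d, x) \<in> augmented \<longleftrightarrow> x \<in> {k, t}" for x
    proof
      assume "(d, x) \<in> augmented"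
      then have "x = t \<or> (d, x) \<in> set q" using out_p[OF dt(1)] by blast
      then show "x \<in> {k, t}" using cyclic_walk_unique(1)[OF q k] by blast
    qed (use k dt(1) in \<open>auto simp: augmented_def\<close>)
    then have "{k. (j, k) \<in> augmented} = {k, t}" using True by blast
    moreover have "(k, t) \<in> augmented" using d_successor_private[OF k] by (simp add: augmented_def)
    ultimately show ?thesis by (intro exI[of _ "[k, t]"]) auto
  next
    case False
    then have "{k. (j, k) \<in> augmented} = {s}" using out_p[OF s] s unfolding augmented_def by blast
    then show ?thesis by (intro exI[of _ "[s]"]) auto
  qed
next
  case False
  then have "j \<in> fst ` set q" using cover by blast
  then obtain s where s: "(j, s) \<in> set q" by auto
  have "(j, k) \<notin> set p" for k using False by force
  then have out: "{k. (j, k) \<in> augmented} = {s, t}"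
    using cyclic_walk_unique(1)[OF q s] s False unfolding augmented_def by blast
  consider "s = t" | "s \<noteq> t" "s \<notin> fst ` set p" | "s \<noteq> t" "s \<in> fst ` set p" by blast
  then show ?thesis
  proof cases
    case 1
    then show ?thesis using out by (intro exI[of _ "[t]"]) auto
  next
    case 2
    then have "(s, t) \<in> augmented" by (simp add: augmented_def)
    then show ?thesis using out by (intro exI[of _ "[s, t]"]) auto
  next
    case 3
    then have "(t, s) \<in> augmented" using into_p[OF s False] by (simp add: augmented_def)
    then show ?thesis using out by (intro exI[of _ "[t, s]"]) auto
  qed
qed

lemma reach:
  assumes cover: "fst ` set p \<union> fst ` set q = UNIV"
  shows "(x, y) \<in> (set p \<union> set q)\<^sup>*"
proof -
  have mono: "(set p)\<^sup>* \<subseteq> (set p \<union> set q)\<^sup>*" "(set q)\<^sup>* \<subseteq> (set p \<union> set q)\<^sup>*"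
    by (auto intro!: rtrancl_mono del: subsetI)
  have dp: "d \<in> fst ` set p" using dt(1) by force
  have "(x, d) \<in> (set p \<union> set q)\<^sup>*" for x
    using cyclic_walk_reach[OF p _ dp, of x] cyclic_walk_reach[OF q _ dt(3), of x] mono cover by blast
  moreover have "(d, y) \<in> (set p \<union> set q)\<^sup>*" for y
    using cyclic_walk_reach[OF p dp, of y] cyclic_walk_reach[OF q dt(3), of y] mono cover by blast
  ultimately show ?thesis by (rule rtrancl_trans)
qed

end

section \<open>The complete realisation\<close>

lemma no_12_cycles_iff_asym:
  assumes "pverts G = UNIV"
  shows "no_12_cycles G \<longleftrightarrow> asym (parcs G)"
proof
  assume G: "no_12_cycles G"
  show "asym (parcs G)"
  proof (rule asymI, rule notI)
    fix x y assume xy: "(x, y) \<in> parcs G" "(y, x) \<in> parcs G"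
    have "cyclic_walk [(x, y), (y, x)] \<or> cyclic_walk [(x, x)]"
      by (cases "x = y") (auto simp: cyclic_walk_def)
    moreover have "\<not> cyclic_walk [(x, y), (y, x)]" 
      using G xy unfolding no_12_cycles_def cycle_iff_cyclic_walk[OF assms] by force
    moreover have "x \<noteq> y \<or> \<not> cyclic_walk [(x, x)]" 
      using G xy unfolding no_12_cycles_def cycle_iff_cyclic_walk[OF assms] by force
    ultimately show False by (auto simp: cyclic_walk_def)
  qed
next
  assume asym: "asym (parcs G)"
  show "no_12_cycles G"
    unfolding no_12_cycles_def cycle_iff_cyclic_walk[OF assms]
  proof (intro allI impI)
    fix r assume r: "cyclic_walk r \<and> set r \<subseteq> parcs G"
    then obtain u where u: "pcas u r u" by (auto simp: cyclic_walk_def)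
    have "length r \<noteq> 1"
      using u r asymD[OF asym, of u u] by (auto simp: length_Suc_conv)
    moreover have "length r \<noteq> 2"
      using u r asymD[OF asym] by (auto simp: length_Suc_conv numeral_2_eq_2) 
    ultimately show "length r \<noteq> 1 \<and> length r \<noteq> 2" by blast
  qed
qed

lemma strongly_connected_iff_rtrancl:
  assumes "pverts G = UNIV"
  shows "strongly_connected (with_proj G) \<longleftrightarrow> (\<forall>x y. (x, y) \<in> (parcs G)\<^sup>*)"
proof -
  have "reachable (with_proj G) x y \<longleftrightarrow> (x, y) \<in> (parcs G)\<^sup>*" for x y
    using rtrancl_consistent_rtrancl_on[of x y "parcs G" UNIV] rtrancl_on_rtranclI[of x y UNIV "parcs G"]
    by (auto simp: reachable_def assms)
  then show ?thesis by (simp add: strongly_connected_def assms)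
qed

lemma positive_eigenvalue_iff:
  assumes "a j j = 0" "i \<noteq> j"
  shows "(\<exists>e>0. linearisation a j (axis i 1) = e *\<^sub>R axis i 1) \<longleftrightarrow> a j i > 0"
  using assms by (auto simp: linearisation_axis axis_eq_0_iff)

theorem proposition4p3:
  fixes G :: "'v::finite pair_pre_digraph"
    and p q :: "('v \<times> 'v) list" \<comment> \<open>the shorter and the longer cycle\<close>
    and m :: nat
  assumes "pverts G = UNIV"
    and "consists_of_two_cycles G p q"
    and "length p \<ge> 3" and "length q \<ge> 3"
    and "length p \<le> length q"
    and "card (set p \<inter> set q) = m" and "m \<ge> 1"
    and "length p \<le> m + 2"
  shows "\<exists>G' a. complete_realisation G G' a \<and>
           (\<exists>i. positive_transverse a p = {(distribution_vertex G, i)})"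
proof -
  note cycle_iff = cycle_iff_cyclic_walk[OF assms(1)]
  have p: "cyclic_walk p" and q: "cyclic_walk q" and neq: "set p \<noteq> set q"
    and arcs: "parcs G = set p \<union> set q" and cover: "fst ` set p \<union> fst ` set q = UNIV"
    and only: "\<And>r. cyclic_walk r \<Longrightarrow> set r \<subseteq> set p \<union> set q \<Longrightarrow> set r = set p \<or> set r = set q"
    using assms(1,2) unfolding consists_of_two_cycles_def cycle_iff by auto
  have no12: "no_12_cycles G"
    unfolding no_12_cycles_def cycle_iff
  proof (intro allI impI)
    fix r assume r: "cyclic_walk r \<and> set r \<subseteq> parcs G"
    then have "set r = set p \<or> set r = set q" using only arcs by simp
    then have "length r = length p \<or> length r = length q"
      using r p q cyclic_walk_length by metis
    then show "length r \<noteq> 1 \<and> length r \<noteq> 2" using assms(3,4) by linarith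
  qed
  then have asym: "asym (set p \<union> set q)" using no_12_cycles_iff_asym[OF assms(1)] arcs by simp
  interpret short_cycle p q
  proof
    show "(x, x) \<notin> set p \<union> set q" for x using asymD[OF asym, of x x] by blast
    show "set p \<inter> set q \<noteq> {}" using assms(6,7) by (cases "set p \<inter> set q = {}") auto
  qed (use p q neq only assms in blast)+
  obtain d t where "(d, t) \<in> set p" "(d, t) \<notin> set q" "d \<in> fst ` set q"
    using private_edge by blast
  then interpret branching p q d t by unfold_locales
  obtain k where k: "(d, k) \<in> set q" using dt(3) by auto
  have kp: "k \<notin> fst ` set p" by (rule d_successor_private[OF k])
  let ?G' = "\<lparr> pverts = UNIV, parcs = augmented \<rparr>" and ?a = "unit_coeffs augmented"
  have asym': "asym augmented" by (rule asym_augmented) (use asymD[OF asym] in blast)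
  have out: "\<exists>ks. sorted_wrt (\<lambda>i k. (i, k) \<in> augmented) ks \<and> set ks = {k. (j, k) \<in> augmented}" for j
    by (rule out_tournament[OF cover])
  have sub: "parcs G \<subseteq> augmented" by (auto simp: arcs augmented_def)
  have reachable: "(x, y) \<in> (parcs G)\<^sup>*" for x y unfolding arcs by (rule reach[OF cover])
  have "complete_realisation G ?G' ?a"
    unfolding complete_realisation_def
  proof (intro conjI)
    show "strongly_connected (with_proj G)"
      using reachable by (simp add: strongly_connected_iff_rtrancl[OF assms(1)])
    show "strongly_connected (with_proj ?G')"
      using reachable rtrancl_mono[OF sub] by (subst strongly_connected_iff_rtrancl) auto
    show "no_12_cycles ?G'" using asym' by (simp add: no_12_cycles_iff_asym)
    show "simplex_coeffs ?G' ?a" by (simp add: simplex_coeffs_def unit_coeffs_def)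
    show "network_realises ?a ?G'"
      unfolding network_realises_def using edge_connection[OF asym'] by simp
    show "complete_network ?a" by (rule complete_network_unit_coeffs[OF asym' out])
  qed (use assms(1) no12 sub in simp_all)
  moreover have "distribution_vertex G = d"
    unfolding distribution_vertex_def
  proof (rule the_equality)
    have eq: "out_arcs (with_proj G) v = {e \<in> set p \<union> set q. fst e = v}" for v
      by (simp add: out_arcs_def arcs)
    have "{(d, t), (d, k)} \<subseteq> out_arcs (with_proj G) d" using dt(1) k by (auto simp: eq)
    then have "card {(d, t), (d, k)} \<le> out_degree (with_proj G) d"
      unfolding out_degree_def eq by (intro card_mono) auto
    moreover have "t \<noteq> k" using dt k by auto
    ultimately show "1 < out_degree (with_proj G) d" by simp
    fix v assume "1 < out_degree (with_proj G) v"
    then have "\<not> card (out_arcs (with_proj G) v) \<le> Suc 0" by (simp add: out_degree_def)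
    then obtain w w' where "w \<noteq> w'" "(v, w) \<in> set p \<union> set q" "(v, w') \<in> set p \<union> set q"
      by (subst (asm) card_le_Suc0_iff_eq) (auto simp: eq)
    then show "v = d" using branch_unique by blast
  qed
  moreover have "positive_transverse ?a p = {(d, k)}"
  proof (intro equalityI subrelI)
    fix j i assume "(j, i) \<in> positive_transverse ?a p"
    then obtain s where "(j, s) \<in> set p" "i \<noteq> j" "i \<noteq> s" "?a j i > 0"
      unfolding positive_transverse_def using positive_eigenvalue_iff[of ?a j i]
      by (auto simp: unit_coeffs_def)
    then have "j = d" "(d, i) \<in> set q"
      using out_p[of j s i] by (auto simp: unit_coeffs_def split: if_splits)
    then show "(j, i) \<in> {(d, k)}" using cyclic_walk_unique(1)[OF q k] by blast
  next
    fix j i assume "(j, i) \<in> {(d, k)}"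
    then have ji: "j = d" "i = k" by auto
    have dp: "d \<in> fst ` set p" using dt(1) by force
    then obtain u where u: "(u, d) \<in> set p" using cyclic_walk_fst(2)[OF p] by auto
    then have "u \<in> fst ` set p" by force
    then have "k \<notin> {d, u, t}" using kp dp t_in_p by auto
    moreover from this k have "\<exists>e>0. linearisation ?a d (axis k 1) = e *\<^sub>R axis k 1"
      by (subst positive_eigenvalue_iff) (auto simp: unit_coeffs_def augmented_def)
    ultimately show "(j, i) \<in> positive_transverse ?a p"
      unfolding positive_transverse_def ji using u dt(1) by blast
  qed
  ultimately show ?thesis by blast
qed

end
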